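(* Let $G=\{g_0=e,g_1,\dots,g_{n-1}\}$ be a finite group of order $n$ of transformations $g_i:(x,t,u)\mapsto(g_i(x,t),u)$ which is admitted by the PDE $u_t+\mathcal N[u]=0$, $(x,t)\in[a,b]\times[-T,T]$. Let $D\subset\mathbb R^2$ be the set of input points $\mathbf x^{(0)}=(x,t)^T$, on which $G$ acts. Let $L\ge 2$, let $n_1,\dots,n_{L-1}$ be positive integers, let $\sigma$ be an activation function, and let $\mathbf w_1\in\mathbb R^{n_1\times 2}$, $\mathbf w_l^{(j)}\in\mathbb R^{n_l\times n_{l-1}}$ ($1<l<L$, $0\le j\le n-1$), $\mathbf w_L\in\mathbb R^{1\times n_{L-1}}$, $\mathbf b_l\in\mathbb R^{n_l}$ ($1\le l\le L-1$), $\mathbf b_L\in\mathbb R$ be arbitrary (initialized) weight matrices and biases. Consider the neural network with $L-1$ hidden layers constructed as follows. 1) First hidden layer: the input $\mathbf x^{(0)}$ is extended to $$X^{(0)}=\begin{pmatrix}\mathbf x^{(0)}\\ g_1\mathbf x^{(0)}\\ \vdots\\ g_{n-1}\mathbf x^{(0)}\end{pmatrix},$$ and the weight matrix $\mathbf W_1=\mathbf w_1$ and bias $\mathbf B_1=\mathbf b_1$ are applied to each of the $n$ components of $X^{(0)}$, giving the $n$ blocks $\sigma(\mathbf w_1\,g_i\mathbf x^{(0)}+\mathbf b_1)$, $i=0,\dots,n-1$. 2) $l$-th hidden layer, $1<l<L$: the weight matrix and bias vector are $$\mathbf W_l=\begin{pmatrix}\widehat{\mathbf W}_l\Lambda_0\\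 \widehat{\mathbf W}_l\Lambda_1\\ \vdots\\ \widehat{\mathbf W}_l\Lambda_{n-1}\end{pmatrix},\qquad \mathbf B_l=\begin{pmatrix}\mathbf b_l\\ \mathbf b_l\\ \vdots\\ \mathbf b_l\end{pmatrix},\qquad \widehat{\mathbf W}_l=\big(\mathbf w_l^{(0)},\mathbf w_l^{(1)},\dots,\mathbf w_l^{(n-1)}\big),$$ where $\Lambda_j$ is the block permutation matrix associated with $g_j$ in the Cayley table of $G$. 3) Output layer: the weight matrix is $\mathbf W_L=(\mathbf w_L,\mathbf w_L,\dots,\mathbf w_L)$ ($n$ copies) and the bias is $\mathbf B_L=\mathbf b_L$. Then this network is invariant under $G$: its output $u(\mathbf x^{(0)})$ satisfies $u(g\,\mathbf x^{(0)})=u(\mathbf x^{(0)})$ for every $g\in G$ and every $\mathbf x^{(0)}\in D$.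
   Context: Here $u=u(x,t)$ is the unknown and $\mathcal N[u]$ denotes a smooth function of $u$ and its $x$-derivatives up to order $r$. A PDE is admitted by (invariant under) $G$ if it is form-preserving under every transformation in $G$. Group products act by composition: $(g_ig_j)\mathbf x=g_i(g_j\mathbf x)$. Network evaluation: the block outputs of the first hidden layer are stacked into a vector $Y_1\in\mathbb R^{n n_1}$ whose $i$-th block is $\sigma(\mathbf w_1 g_i\mathbf x^{(0)}+\mathbf b_1)$; for $1<l<L$, $Y_l=\sigma(\mathbf W_lY_{l-1}+\mathbf B_l)\in\mathbb R^{n n_l}$; the output is $u(\mathbf x^{(0)})=\mathbf W_LY_{L-1}+\mathbf B_L\in\mathbb R$. The activation function $\sigma:\mathbb R\to\mathbb R$ is applied componentwise. Such a network is called a symmetry-enhanced deep neural network (sDNN). Block permutation $\Lambda_j$ (acting on vectors consisting of $n$ blocks of size $n_{l-1}$): for $0\le i,j\le n-1$ let $k_i^j$ be the index with $g_ig_j=g_{k_i^j}$; then $\Lambda_j\,(y_0,\dots,y_{n-1})^T=(y_{k_0^j},\dots,y_{k_{n-1}^j})^T$ for blocks $y_i\in\mathbb R^{n_{l-1}}$. *)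

theory Defs
  imports
    "HOL-Analysis.Analysis"
    "HOL-Algebra.Bij"
    "Jordan_Normal_Form.Matrix"
begin

unbundle no vec_syntax

section \<open>Invariance of the PDE\<close>

primrec C_diff_on :: "nat \<Rightarrow> 'a::euclidean_space set \<Rightarrow> ('a \<Rightarrow> 'b::real_normed_vector) \<Rightarrow> bool" where
  "C_diff_on 0 S f \<longleftrightarrow> continuous_on S f"
| "C_diff_on (Suc k) S f \<longleftrightarrow>
     f differentiable_on S \<and> (\<forall>v. C_diff_on k S (\<lambda>x. frechet_derivative f (at x) v))"

text \<open>Only meant for open \<open>S\<close>.\<close>

definition smooth_on :: "'a::euclidean_space set \<Rightarrow> ('a \<Rightarrow> 'b::real_normed_vector) \<Rightarrow> bool" where
  "smooth_on S f \<longleftrightarrow> (\<forall>k. C_diff_on k S f)"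

definition dx :: "nat \<Rightarrow> (real \<times> real \<Rightarrow> real) \<Rightarrow> real \<times> real \<Rightarrow> real" where
  "dx k u p = (deriv ^^ k) (\<lambda>x. u (x, snd p)) (fst p)"

definition dt :: "(real \<times> real \<Rightarrow> real) \<Rightarrow> real \<times> real \<Rightarrow> real" where
  "dt u p = deriv (\<lambda>t. u (fst p, t)) (snd p)"

text \<open>
  The left-hand side of \<open>u\<^sub>t + N[u] = 0\<close>, with \<open>N[u] = F (u, u\<^sub>x, u\<^sub>x\<^sub>x, \<dots>)\<close>. The coordinates of the
  argument of \<open>F\<close> are indexed by a finite type, and \<open>ord i\<close> is the order of the derivative
  that goes into coordinate \<open>i\<close>. If \<open>ord\<close> is a bijection onto \<open>{..r}\<close>, then each derivative
  of order at most \<open>r\<close> occurs exactly once.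
\<close>

definition pde_lhs ::
  "(real ^ 'm::finite \<Rightarrow> real) \<Rightarrow> ('m \<Rightarrow> nat) \<Rightarrow> (real \<times> real \<Rightarrow> real) \<Rightarrow> real \<times> real \<Rightarrow> real" where
  "pde_lhs F ord u p = dt u p + F (vec_lambda (\<lambda>i. dx (ord i) u p))"

text \<open>
  The transformation \<open>(x, t, u) \<mapsto> (h (x, t), u)\<close> maps the graph of a function \<open>u\<close> to the graph of
  \<open>u \<circ> inv_into UNIV h\<close>, which is therefore the unknown in the new variables. The PDE on \<open>\<Omega>\<close> is
  form-preserving under \<open>h\<close> if the change of variables turns it, at each point and for arbitrary
  smooth \<open>u\<close>, into the same equation in the new variables. An overall nonvanishing factor (such as
  the sign produced by \<open>(x, t) \<mapsto> (-x, -t)\<close>) is allowed, hence the equivalence of the two equations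
  rather than equality of the left-hand sides. The open set \<open>M\<close> is the region on which the
  transformations are smooth, which need not be the whole plane: a group that acts only on a region
  is extended by the identity outside it.
\<close>

definition form_preserving ::
  "(real ^ 'm::finite \<Rightarrow> real) \<Rightarrow> ('m \<Rightarrow> nat) \<Rightarrow> (real \<times> real) set \<Rightarrow> (real \<times> real) set \<Rightarrow>
   (real \<times> real \<Rightarrow> real \<times> real) \<Rightarrow> bool" where
  "form_preserving F ord M \<Omega> h \<longleftrightarrow>
     (\<forall>u p. smooth_on M u \<longrightarrow> p \<in> \<Omega> \<longrightarrow>
        (pde_lhs F ord (u \<circ> inv_into UNIV h) (h p) = 0 \<longleftrightarrow> pde_lhs F ord u p = 0))"

definition admitted_by_pde ::
  "(real ^ 'm::finite \<Rightarrow> real) \<Rightarrow> ('m \<Rightarrow> nat) \<Rightarrow> (real \<times> real) set \<Rightarrow>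
   (real \<times> real \<Rightarrow> real \<times> real) set \<Rightarrow> bool" where
  "admitted_by_pde F ord \<Omega> G \<longleftrightarrow>
     (\<exists>M. open M \<and> \<Omega> \<subseteq> M \<and>
        (\<forall>h\<in>G. h ` M \<subseteq> M \<and> smooth_on M h \<and> form_preserving F ord M \<Omega> h))"


section \<open>The symmetry-enhanced network\<close>

text \<open>Index \<open>k\<close> with \<open>g i \<circ> g j = g k\<close>, for \<open>G\<close> enumerated as \<open>g 0, \<dots>, g (n - 1)\<close>.\<close>

definition cayley_index :: "nat \<Rightarrow> (nat \<Rightarrow> 'a \<Rightarrow> 'a) \<Rightarrow> nat \<Rightarrow> nat \<Rightarrow> nat" where
  "cayley_index n g i j = (THE k. k < n \<and> g k = g i \<circ> g j)"

text \<open>Stacked vectors and block matrices, for \<open>n\<close> blocks of equal size; all indices start at \<open>0\<close>.\<close>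

definition stack_vec :: "nat \<Rightarrow> nat \<Rightarrow> (nat \<Rightarrow> 'a Matrix.vec) \<Rightarrow> 'a Matrix.vec" where
  "stack_vec n m y = Matrix.vec (n * m) (\<lambda>s. y (s div m) $ (s mod m))"

definition block_vec :: "nat \<Rightarrow> 'a Matrix.vec \<Rightarrow> nat \<Rightarrow> 'a Matrix.vec" where
  "block_vec m v i = Matrix.vec m (\<lambda>s. v $ (i * m + s))"

definition block_row :: "nat \<Rightarrow> nat \<Rightarrow> nat \<Rightarrow> (nat \<Rightarrow> 'a Matrix.mat) \<Rightarrow> 'a Matrix.mat" where
  "block_row n r c A = Matrix.mat r (n * c) (\<lambda>(i, s). A (s div c) $$ (i, s mod c))"

definition block_col :: "nat \<Rightarrow> nat \<Rightarrow> nat \<Rightarrow> (nat \<Rightarrow> 'a Matrix.mat) \<Rightarrow> 'a Matrix.mat" where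
  "block_col n r c A = Matrix.mat (n * r) c (\<lambda>(s, j). A (s div r) $$ (s mod r, j))"

text \<open>\<open>\<Lambda>\<^sub>j\<close> for blocks of size \<open>m\<close>: block \<open>i\<close> of the result is block \<open>cayley_index n g i j\<close> of the argument.\<close>

definition block_perm_mat :: "nat \<Rightarrow> (nat \<Rightarrow> 'a \<Rightarrow> 'a) \<Rightarrow> nat \<Rightarrow> nat \<Rightarrow> real Matrix.mat" where
  "block_perm_mat n g m j = Matrix.mat (n * m) (n * m)
     (\<lambda>(s, s'). if s' = cayley_index n g (s div m) j * m + s mod m then 1 else 0)"

lemma block_perm_mat_stack_vec:
  assumes "\<And>i. i < n \<Longrightarrow> cayley_index n g i j < n"
  shows "block_perm_mat n g m j *\<^sub>v stack_vec n m y = stack_vec n m (\<lambda>i. y (cayley_index n g i j))"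
proof (rule eq_vecI)
  fix s assume "s < dim_vec (stack_vec n m (\<lambda>i. y (cayley_index n g i j)))"
  then have s: "s < n * m" by (simp add: stack_vec_def)
  then have m: "m > 0" by (cases m) auto
  define k where "k = cayley_index n g (s div m) j"
  have "s div m < n" using s m by (simp add: less_mult_imp_div_less)
  then have "k < n" unfolding k_def by (rule assms)
  then have "Suc k * m \<le> n * m" by (intro mult_le_mono1) simp
  moreover have "s mod m < m" using m by simp
  ultimately have q: "k * m + s mod m < n * m" by simp
  have dim: "dim_vec (stack_vec n m y) = n * m" by (simp add: stack_vec_def)
  have "(block_perm_mat n g m j *\<^sub>v stack_vec n m y) $ s =
      (\<Sum>s'\<in>{0..<n * m}. (if s' = k * m + s mod m then 1 else 0) * stack_vec n m y $ s')"
    using s by (simp add: block_perm_mat_def scalar_prod_def dim k_def)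
  also have "\<dots> = (\<Sum>s'\<in>{0..<n * m}. if s' = k * m + s mod m then stack_vec n m y $ s' else 0)"
    by (rule sum.cong) auto
  also have "\<dots> = stack_vec n m y $ (k * m + s mod m)" using q by simp
  also have "\<dots> = y k $ (s mod m)" using q m by (simp add: stack_vec_def)
  finally show "(block_perm_mat n g m j *\<^sub>v stack_vec n m y) $ s =
      stack_vec n m (\<lambda>i. y (cayley_index n g i j)) $ s"
    using s by (simp add: stack_vec_def k_def)
qed (simp add: block_perm_mat_def stack_vec_def)

text \<open>\<open>W\<^sub>l\<close> and \<open>B\<^sub>l\<close> for \<open>1 < l < L\<close>, with \<open>w j\<close> of size \<open>m' \<times> m\<close> and \<open>b\<close> of length \<open>m'\<close>.\<close>

definition hidden_weight ::
  "nat \<Rightarrow> (nat \<Rightarrow> 'a \<Rightarrow> 'a) \<Rightarrow> nat \<Rightarrow> nat \<Rightarrow> (nat \<Rightarrow> real Matrix.mat) \<Rightarrow> real Matrix.mat" where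
  "hidden_weight n g m m' w =
     block_col n m' (n * m) (\<lambda>j. block_row n m' m w * block_perm_mat n g m j)"

definition hidden_bias :: "nat \<Rightarrow> nat \<Rightarrow> real Matrix.vec \<Rightarrow> real Matrix.vec" where
  "hidden_bias n m' b = stack_vec n m' (\<lambda>_. b)"

definition point_vec :: "real \<times> real \<Rightarrow> real Matrix.vec" where
  "point_vec p = vec_of_list [fst p, snd p]"

definition extended_input ::
  "nat \<Rightarrow> (nat \<Rightarrow> real \<times> real \<Rightarrow> real \<times> real) \<Rightarrow> real \<times> real \<Rightarrow> real Matrix.vec" where
  "extended_input n g p = stack_vec n 2 (\<lambda>i. point_vec (g i p))"

text \<open>
  \<open>layer \<dots> l\<close> is the vector \<open>X\<^sup>(\<^sup>0\<^sup>)\<close> for \<open>l = 0\<close> and \<open>Y\<^sub>l\<close> for \<open>1 \<le> l < L\<close>. The width of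
  layer \<open>l\<close> is \<open>n * d l\<close>; the weights are \<open>w1\<close> for the first layer and \<open>w l j\<close> for \<open>1 < l < L\<close>.
\<close>

fun layer ::
  "nat \<Rightarrow> (nat \<Rightarrow> real \<times> real \<Rightarrow> real \<times> real) \<Rightarrow> (nat \<Rightarrow> nat) \<Rightarrow> (real \<Rightarrow> real) \<Rightarrow> real Matrix.mat \<Rightarrow>
   (nat \<Rightarrow> nat \<Rightarrow> real Matrix.mat) \<Rightarrow> (nat \<Rightarrow> real Matrix.vec) \<Rightarrow> real \<times> real \<Rightarrow> nat \<Rightarrow> real Matrix.vec"
where
  "layer n g d \<sigma> w1 w b p 0 = extended_input n g p"
| "layer n g d \<sigma> w1 w b p (Suc 0) =
     stack_vec n (d 1)
       (\<lambda>i. map_vec \<sigma> (w1 *\<^sub>v block_vec 2 (layer n g d \<sigma> w1 w b p 0) i + b 1))"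
| "layer n g d \<sigma> w1 w b p (Suc (Suc l)) =
     map_vec \<sigma>
       (hidden_weight n g (d (Suc l)) (d (Suc (Suc l))) (w (Suc (Suc l)))
          *\<^sub>v layer n g d \<sigma> w1 w b p (Suc l)
        + hidden_bias n (d (Suc (Suc l))) (b (Suc (Suc l))))"

definition output_weight :: "nat \<Rightarrow> nat \<Rightarrow> real Matrix.mat \<Rightarrow> real Matrix.mat" where
  "output_weight n m wL = block_row n 1 m (\<lambda>_. wL)"

definition sdnn ::
  "nat \<Rightarrow> (nat \<Rightarrow> real \<times> real \<Rightarrow> real \<times> real) \<Rightarrow> nat \<Rightarrow> (nat \<Rightarrow> nat) \<Rightarrow> (real \<Rightarrow> real) \<Rightarrow>
   real Matrix.mat \<Rightarrow> (nat \<Rightarrow> nat \<Rightarrow> real Matrix.mat) \<Rightarrow> real Matrix.mat \<Rightarrow>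
   (nat \<Rightarrow> real Matrix.vec) \<Rightarrow> real \<Rightarrow> real \<times> real \<Rightarrow> real" where
  "sdnn n g L d \<sigma> w1 w wL b bL p =
     (output_weight n (d (L - 1)) wL *\<^sub>v layer n g d \<sigma> w1 w b p (L - 1)) $ 0 + bL"

end

theory Submission
  imports Defs
begin

text \<open>
  Each hidden layer has the form \<open>(f (g\<^sub>0 x), \<dots>, f (g\<^sub>n\<^sub>-\<^sub>1 x))\<close> for a function \<open>f\<close> of a single point:
  \<open>\<Lambda>\<^sub>j\<close> turns \<open>(f (g\<^sub>i x))\<^sub>i\<close> into \<open>(f (g\<^sub>i (g\<^sub>j x)))\<^sub>i\<close>, so block \<open>j\<close> of the next layer is again a function
  of \<open>g\<^sub>j x\<close> alone. The output sums \<open>w\<^sub>L f (g\<^sub>i x)\<close> over the group, and replacing \<open>x\<close> by \<open>h x\<close> merely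
  permutes the summands.
\<close>

lemma dim_stack_vec [simp]: "dim_vec (stack_vec n m y) = n * m"
  by (simp add: stack_vec_def)

lemma stack_vec_carrier [simp]: "stack_vec n m y \<in> carrier_vec (n * m)"
  by (simp add: carrier_vecI)

lemma stack_vec_index:
  assumes "s < n * m"
  shows "stack_vec n m y $ s = y (s div m) $ (s mod m)"
  using assms by (simp add: stack_vec_def)

lemma stack_vec_index_block:
  assumes "i < n" "s < m"
  shows "stack_vec n m y $ (i * m + s) = y i $ s"
proof -
  have "Suc i * m \<le> n * m" using assms(1) by (intro mult_le_mono1) simp
  then have "i * m + s < n * m" using assms(2) by simp
  then show ?thesis using assms(2) by (simp add: stack_vec_index)
qed

lemma stack_vec_cong:
  assumes "\<And>i. i < n \<Longrightarrow> y i = z i"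
  shows "stack_vec n m y = stack_vec n m z"
  using assms by (intro eq_vecI) (simp_all add: stack_vec_index less_mult_imp_div_less)

lemma mod_less_of_less_mult:
  fixes s n m :: nat
  assumes "s < n * m"
  shows "s mod m < m"
  using assms by (cases m) auto

lemma block_vec_stack_vec:
  assumes "i < n" "dim_vec (y i) = m"
  shows "block_vec m (stack_vec n m y) i = y i"
  using assms by (intro eq_vecI) (simp_all add: block_vec_def stack_vec_index_block)

lemma block_row_carrier [simp]: "block_row n r c A \<in> carrier_mat r (n * c)"
  by (simp add: block_row_def)

lemma block_perm_mat_carrier [simp]: "block_perm_mat n g m j \<in> carrier_mat (n * m) (n * m)"
  by (simp add: block_perm_mat_def)

lemma block_col_mult_vec:
  fixes A :: "nat \<Rightarrow> real Matrix.mat"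
  assumes A: "\<And>j. j < n \<Longrightarrow> A j \<in> carrier_mat r c" and v: "v \<in> carrier_vec c"
  shows "block_col n r c A *\<^sub>v v = stack_vec n r (\<lambda>j. A j *\<^sub>v v)"
proof (rule eq_vecI)
  fix s assume "s < dim_vec (stack_vec n r (\<lambda>j. A j *\<^sub>v v))"
  then have s: "s < n * r" by simp
  then have j: "s div r < n" and i: "s mod r < r"
    by (simp_all add: less_mult_imp_div_less mod_less_of_less_mult)
  have "row (block_col n r c A) s = row (A (s div r)) (s mod r)"
    using s i A[OF j] by (intro eq_vecI) (auto simp: block_col_def)
  then show "(block_col n r c A *\<^sub>v v) $ s = stack_vec n r (\<lambda>j. A j *\<^sub>v v) $ s"
    using s i A[OF j] by (simp add: stack_vec_index block_col_def)
qed (simp add: block_col_def)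

text \<open>The interval below \<open>n * m\<close> splits into \<open>n\<close> consecutive
  intervals of length \<open>m\<close>, on the \<open>i\<close>-th of which \<open>s div m\<close>
  is constantly \<open>i\<close>.\<close>

lemma sum_blocks:
  fixes f :: "nat \<Rightarrow> nat \<Rightarrow> 'a::comm_monoid_add"
  shows "(\<Sum>s<n * m. f (s div m) (s mod m)) = (\<Sum>i<n. \<Sum>s<m. f i s)"
proof -
  have "(\<Sum>s<n * m. f (s div m) (s mod m)) =
      (\<Sum>i<n. \<Sum>s=i * m..<i * m + m. f (s div m) (s mod m))"
    by (rule sum.nat_group[symmetric])
  also have "\<dots> = (\<Sum>i<n. \<Sum>s<m. f i s)"
  proof (rule sum.cong[OF refl])
    fix i
    have "(\<Sum>s=i * m..<i * m + m. f (s div m) (s mod m)) =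
        (\<Sum>s=0..<m. f ((s + i * m) div m) ((s + i * m) mod m))"
      \<comment> \<open>Shifting by \<open>i * m\<close> makes the \<open>i\<close>-th interval
        start at \<open>0\<close>, so that quotient and remainder become \<open>i\<close> and
        \<open>s\<close>.\<close>
      using sum.shift_bounds_nat_ivl[of "\<lambda>s. f (s div m) (s mod m)" 0 "i * m" m]
      by (simp add: add.commute)
    also have "\<dots> = (\<Sum>s<m. f i s)"
      by (rule sum.cong) auto
    finally show "(\<Sum>s=i * m..<i * m + m. f (s div m) (s mod m)) = (\<Sum>s<m. f i s)" .
  qed
  finally show ?thesis .
qed

text \<open>All blocks share the row \<open>wL\<close>, so the output is a symmetric function of the
  blocks; a permutation of them cannot change it.\<close>

lemma output_weight_mult_stack_vec:
  "(output_weight n m wL *\<^sub>v stack_vec n m y) $ 0 = (\<Sum>i<n. \<Sum>s<m. wL $$ (0, s) * y i $ s)"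
proof -
  have "(output_weight n m wL *\<^sub>v stack_vec n m y) $ 0 =
      (\<Sum>s<n * m. wL $$ (0, s mod m) * y (s div m) $ (s mod m))"
    by (simp add: output_weight_def block_row_def scalar_prod_def stack_vec_index
        atLeast0LessThan)
  then show ?thesis
    by (simp add: sum_blocks[of "\<lambda>i s. wL $$ (0, s) * y i $ s"])
qed

text \<open>Closure under composition makes the Cayley indices meaningful; bijectivity makes right
  translation cancellable.\<close>

locale enumerated_transformations =
  fixes n :: nat and g :: "nat \<Rightarrow> 'a \<Rightarrow> 'a" and G :: "('a \<Rightarrow> 'a) set"
  assumes enum: "bij_betw g {..<n} G"
    and comp_closed: "h \<in> G \<Longrightarrow> k \<in> G \<Longrightarrow> h \<circ> k \<in> G"
    and bij: "h \<in> G \<Longrightarrow> bij h"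
begin

lemma g_mem: "i < n \<Longrightarrow> g i \<in> G"
  using enum by (auto simp: bij_betw_def)

text \<open>The definite description is proper: closure gives existence of the index, injectivity of
  the enumeration gives uniqueness.\<close>

lemma cayley_index:
  assumes "i < n" "j < n"
  shows "cayley_index n g i j < n" "g (cayley_index n g i j) = g i \<circ> g j"
proof -
  have "g i \<circ> g j \<in> G" using assms by (intro comp_closed g_mem)
  then have "\<exists>!k. k < n \<and> g k = g i \<circ> g j"
    using enum unfolding bij_betw_def inj_on_def by (metis imageE lessThan_iff)
  then have "cayley_index n g i j < n \<and> g (cayley_index n g i j) = g i \<circ> g j"
    unfolding cayley_index_def by (rule theI')
  then show "cayley_index n g i j < n" "g (cayley_index n g i j) = g i \<circ> g j" by auto
qed

lemma finite_G: "finite G"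
  using enum bij_betw_finite by blast

text \<open>Right translation by \<open>h\<close> permutes \<open>G\<close>. It is injective because
  \<open>h\<close> is surjective, and an injective self-map of a finite set is onto.\<close>

lemma sum_translate:
  fixes f :: "'a \<Rightarrow> 'b::comm_monoid_add"
  assumes h: "h \<in> G"
  shows "(\<Sum>i<n. f (g i (h p))) = (\<Sum>i<n. f (g i p))"
proof -
  have "inj_on (\<lambda>k. k \<circ> h) G"
    using bij[OF h] by (auto intro!: inj_onI simp: fun_eq_iff bij_def surj_def) metis
  moreover from this have "(\<lambda>k. k \<circ> h) ` G = G"
    using finite_G h by (intro endo_inj_surj) (auto intro: comp_closed)
  ultimately have "bij_betw (\<lambda>k. k \<circ> h) G G" by (simp add: bij_betw_def)
  then have "(\<Sum>k\<in>G. f ((k \<circ> h) p)) = (\<Sum>k\<in>G. f (k p))"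
    by (rule sum.reindex_bij_betw)
  then show ?thesis
    using sum.reindex_bij_betw[OF enum, of "\<lambda>k. f (k (h p))"]
      sum.reindex_bij_betw[OF enum, of "\<lambda>k. f (k p)"] by simp
qed

text \<open>The Cayley index encodes \<open>g i \<circ> g j\<close> with \<open>g j\<close> applied
  first, so \<open>\<Lambda>\<^sub>j\<close> acts by moving the base point from \<open>p\<close> to
  \<open>g j p\<close>. Hence block \<open>j\<close> depends on \<open>g j p\<close> only, by a rule
  common to all \<open>j\<close>.\<close>

lemma hidden_weight_mult_stack_vec:
  "hidden_weight n g m m' w *\<^sub>v stack_vec n m (\<lambda>i. f (g i p)) =
     stack_vec n m' (\<lambda>j. block_row n m' m w *\<^sub>v stack_vec n m (\<lambda>i. f (g i (g j p))))"
proof -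
  have "hidden_weight n g m m' w *\<^sub>v stack_vec n m (\<lambda>i. f (g i p)) =
      stack_vec n m' (\<lambda>j. (block_row n m' m w * block_perm_mat n g m j)
        *\<^sub>v stack_vec n m (\<lambda>i. f (g i p)))"
    unfolding hidden_weight_def
    by (intro block_col_mult_vec mult_carrier_mat[OF block_row_carrier block_perm_mat_carrier]
        stack_vec_carrier)
  also have "\<dots> = stack_vec n m' (\<lambda>j. block_row n m' m w *\<^sub>v stack_vec n m (\<lambda>i. f (g i (g j p))))"
  proof (rule stack_vec_cong)
    fix j assume j: "j < n"
    have "(block_row n m' m w * block_perm_mat n g m j) *\<^sub>v stack_vec n m (\<lambda>i. f (g i p)) =
        block_row n m' m w *\<^sub>v (block_perm_mat n g m j *\<^sub>v stack_vec n m (\<lambda>i. f (g i p)))"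
      by (rule assoc_mult_mat_vec[OF block_row_carrier block_perm_mat_carrier stack_vec_carrier])
    also have "block_perm_mat n g m j *\<^sub>v stack_vec n m (\<lambda>i. f (g i p)) =
        stack_vec n m (\<lambda>i. f (g (cayley_index n g i j) p))"
      using cayley_index(1)[OF _ j] by (rule block_perm_mat_stack_vec)
    also have "\<dots> = stack_vec n m (\<lambda>i. f (g i (g j p)))"
      by (rule stack_vec_cong) (simp add: cayley_index(2)[OF _ j])
    finally show "(block_row n m' m w * block_perm_mat n g m j) *\<^sub>v stack_vec n m (\<lambda>i. f (g i p)) =
        block_row n m' m w *\<^sub>v stack_vec n m (\<lambda>i. f (g i (g j p)))" .
  qed
  finally show ?thesis .
qed

end

text \<open>The point is the order of the quantifiers: one \<open>f\<close> serves all inputs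
  \<open>p\<close>. It is built by induction on the depth, starting at the first hidden layer, whose
  weights are shared by all blocks.\<close>

lemma layer_eq_stack_vec:
  assumes "enumerated_transformations n g G"
    and b: "\<And>k. 1 < k \<Longrightarrow> k \<le> Suc l \<Longrightarrow> b k \<in> carrier_vec (d k)"
  shows "\<exists>f. \<forall>p. layer n g d \<sigma> w1 w b p (Suc l) = stack_vec n (d (Suc l)) (\<lambda>i. f (g i p))"
  using b
proof (induction l)
  case 0
  have "layer n g d \<sigma> w1 w b p (Suc 0) =
      stack_vec n (d (Suc 0)) (\<lambda>i. map_vec \<sigma> (w1 *\<^sub>v point_vec (g i p) + b 1))" for p
    by (auto intro!: stack_vec_cong simp: extended_input_def block_vec_stack_vec point_vec_def)
  then show ?case by (intro exI[of _ "\<lambda>q. map_vec \<sigma> (w1 *\<^sub>v point_vec q + b 1)"]) simp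
next
  case (Suc l)
  interpret enumerated_transformations n g G by fact
  let ?m = "d (Suc l)" and ?m' = "d (Suc (Suc l))" and ?b = "b (Suc (Suc l))"
  let ?W = "block_row n ?m' ?m (w (Suc (Suc l)))"
  obtain f where f: "\<And>p. layer n g d \<sigma> w1 w b p (Suc l) = stack_vec n ?m (\<lambda>i. f (g i p))"
    using Suc.IH Suc.prems by (metis le_SucI)
  \<comment> \<open>This is what any block of the next layer computes, with its base point
    \<open>g j p\<close> replaced by a variable \<open>q\<close>.\<close>
  define f' where "f' q = map_vec \<sigma> (?W *\<^sub>v stack_vec n ?m (\<lambda>i. f (g i q)) + ?b)" for q
  \<comment> \<open>A vector sum takes its dimension from the second summand, so this makes the
    blocks \<open>f' q\<close> have length \<open>?m'\<close>.\<close>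
  have b: "dim_vec ?b = ?m'" using Suc.prems[of "Suc (Suc l)"] by simp
  have "layer n g d \<sigma> w1 w b p (Suc (Suc l)) = stack_vec n ?m' (\<lambda>j. f' (g j p))" for p
    by (rule eq_vecI) (simp_all add: f hidden_weight_mult_stack_vec hidden_bias_def
        stack_vec_index mod_less_of_less_mult f'_def b block_row_def)
  then show ?case by blast
qed

theorem theorem3p1:
  fixes G :: "(real \<times> real \<Rightarrow> real \<times> real) set"
    and g :: "nat \<Rightarrow> real \<times> real \<Rightarrow> real \<times> real"
    and F :: "real ^ 'm::finite \<Rightarrow> real"
    and ord :: "'m \<Rightarrow> nat"
    and a b\<^sub>0 T :: real
    and D :: "(real \<times> real) set"
    and n r L :: nat
    and d :: "nat \<Rightarrow> nat"
    and \<sigma> :: "real \<Rightarrow> real"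
    and w1 wL :: "real Matrix.mat"
    and w :: "nat \<Rightarrow> nat \<Rightarrow> real Matrix.mat"
    and b :: "nat \<Rightarrow> real Matrix.vec"
    and bL :: real
  assumes group: "subgroup G (BijGroup UNIV)"
    and enum: "bij_betw g {..<n} G"
    and unit: "g 0 = id"
    and F_smooth: "smooth_on UNIV F"
    and F_args: "bij_betw ord UNIV {..r}"
    and admitted: "admitted_by_pde F ord ({a..b\<^sub>0} \<times> {-T..T}) G"
    and acts: "\<And>h. h \<in> G \<Longrightarrow> h ` D \<subseteq> D"
    and depth: "L \<ge> 2"
    and widths: "\<And>l. 1 \<le> l \<Longrightarrow> l < L \<Longrightarrow> d l > 0"
    and w1: "w1 \<in> carrier_mat (d 1) 2"
    and w: "\<And>l j. 1 < l \<Longrightarrow> l < L \<Longrightarrow> j < n \<Longrightarrow> w l j \<in> carrier_mat (d l) (d (l - 1))"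
    and wL: "wL \<in> carrier_mat 1 (d (L - 1))"
    and b: "\<And>l. 1 \<le> l \<Longrightarrow> l < L \<Longrightarrow> b l \<in> carrier_vec (d l)"
  shows "\<forall>h\<in>G. \<forall>p\<in>D. sdnn n g L d \<sigma> w1 w wL b bL (h p) = sdnn n g L d \<sigma> w1 w wL b bL p"
proof (intro ballI)
  fix h p assume h: "h \<in> G" and "p \<in> D"
  have G: "bij k" if "k \<in> G" for k
    using subgroup.mem_carrier[OF group that] by (simp add: BijGroup_def Bij_def)
  \<comment> \<open>The product in \<open>BijGroup UNIV\<close> is composition restricted to the
    carrier set; on \<open>UNIV\<close> the restriction is vacuous.\<close>
  have "h' \<circ> k \<in> G" if "h' \<in> G" "k \<in> G" for h' k
    using subgroup.m_closed[OF group that] G[OF that(1)] G[OF that(2)]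
    by (simp add: BijGroup_def Bij_def compose_def comp_def restrict_def)
  then interpret enumerated_transformations n g G
    using enum G by unfold_locales
  \<comment> \<open>As \<open>L \<ge> 2\<close>, the last layer before the output is a hidden layer,
    not the extended input.\<close>
  obtain l where l: "L - 1 = Suc l" using depth by (cases "L - 1") auto
  obtain f where f:
    "\<And>q. layer n g d \<sigma> w1 w b q (L - 1) = stack_vec n (d (L - 1)) (\<lambda>i. f (g i q))"
    using layer_eq_stack_vec[OF enumerated_transformations_axioms, of l b d \<sigma> w1 w] b l by auto
  have "sdnn n g L d \<sigma> w1 w wL b bL q =
      (\<Sum>i<n. \<Sum>s<d (L - 1). wL $$ (0, s) * f (g i q) $ s) + bL" for q
    by (simp only: sdnn_def f output_weight_mult_stack_vec)
  then show "sdnn n g L d \<sigma> w1 w wL b bL (h p) = sdnn n g L d \<sigma> w1 w wL b bL p"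
    by (simp only: sum_translate[OF h, of "\<lambda>q. \<Sum>s<d (L - 1). wL $$ (0, s) * f q $ s"])
qed

end
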